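(* For every fixed integer $\ell \ge 3$, \[ r(s;\ell) = \Omega\left(2^{(\ell-1)s/2}\right) \] as $s \to \infty$.
   Context: For positive integers $s$ and $\ell$, the multicolor Ramsey number $r(s;\ell)$ is the minimum integer $n$ such that every coloring of the edges of the complete graph $K_n$ with $\ell$ colors contains a monochromatic clique of size $s$. *)

theory Defs
  imports Main "HOL-Library.Landau_Symbols"
begin

definition edge_colouring :: "nat \<Rightarrow> nat \<Rightarrow> (nat set \<Rightarrow> nat) \<Rightarrow> bool" where
  "edge_colouring n l c \<longleftrightarrow> (\<forall>x<n. \<forall>y<n. x \<noteq> y \<longrightarrow> c {x, y} < l)"

definition monochromatic :: "(nat set \<Rightarrow> nat) \<Rightarrow> nat set \<Rightarrow> bool" where
  "monochromatic c K \<longleftrightarrow> (\<exists>i. \<forall>x\<in>K. \<forall>y\<in>K. x \<noteq> y \<longrightarrow> c {x, y} = i)"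

definition ramsey_number :: "nat \<Rightarrow> nat \<Rightarrow> nat" where
  "ramsey_number s l = (LEAST n. \<forall>c. edge_colouring n l c \<longrightarrow>
      (\<exists>K \<subseteq> {..<n}. card K = s \<and> monochromatic c K))"

end

(* Write t = s - 1 and k = l - 1, and identify subsets of {0,...,t-1} with vectors over the
   two-element field, with inner product the parity of the intersection. Give every vertex x
   a random pair (u_i x, v_i x) of vectors with inner product 1, independently for each i < k.
   For x < y the edge {x, y} gets the least colour i < k with u_i x orthogonal to v_i y, and
   colour k if there is none. A clique in a colour i < k gives a triangular matrix of rank at
   most t with ones on the diagonal, so it has at most t < s vertices. A clique of size s in
   colour k requires, for each i independently, that all inner products be 1; choosing the
   pairs one after the other, each choice of u either halves the affine space of admissible v
   or is constant on it, and Lindsey's lemma makes the latter rare. This gives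
   probability 2 ^ (- s^2/2 + O(s)) for each i, and the union bound over the s-subsets allows
   n = 2 ^ (k s/2 - O(1)) vertices. *)

theory Submission
  imports Defs "HOL-Library.Ramsey"
begin

section \<open>Parity inner product and affine spaces over the two-element field\<close>

definition dot :: "nat set \<Rightarrow> nat set \<Rightarrow> bool" where
  "dot u v \<longleftrightarrow> odd (card (u \<inter> v))"

text \<open>Closure under sums of three vectors describes affine subspaces over the two-element
  field without naming a base point; the empty set is included.\<close>

definition xor_affine :: "nat set set \<Rightarrow> bool" where
  "xor_affine V \<longleftrightarrow> (\<forall>x\<in>V. \<forall>y\<in>V. \<forall>z\<in>V. sym_diff x (sym_diff y z) \<in> V)"

lemma dot_commute: "dot u v = dot v u"
  by (simp add: dot_def Int_commute)

lemma dot_empty [simp]: "\<not> dot u {}"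
  by (simp add: dot_def)

text \<open>Points of \<open>x \<inter> y\<close> are counted twice, which leaves the parity
  unchanged.\<close>

lemma dot_sym_diff:
  assumes "finite x" "finite y"
  shows "dot u (sym_diff x y) \<longleftrightarrow> dot u x \<noteq> dot u y"
proof -
  let ?a = "card (u \<inter> (x - y))" and ?b = "card (u \<inter> (y - x))" and ?c = "card (u \<inter> (x \<inter> y))"
  have "card (u \<inter> sym_diff x y) = ?a + ?b"
    by (subst card_Un_disjoint [symmetric]) (use assms in \<open>auto intro!: arg_cong [where f=card]\<close>)
  moreover have "card (u \<inter> x) = ?a + ?c"
    by (subst card_Un_disjoint [symmetric]) (use assms in \<open>auto intro!: arg_cong [where f=card]\<close>)
  moreover have "card (u \<inter> y) = ?b + ?c"
    by (subst card_Un_disjoint [symmetric]) (use assms in \<open>auto intro!: arg_cong [where f=card]\<close>)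
  ultimately show ?thesis by (simp only: dot_def even_add) blast
qed

lemma xor_affine_Pow: "xor_affine (Pow T)"
  by (auto simp: xor_affine_def)

lemma xor_affine_level_set:
  assumes "xor_affine V" "V \<subseteq> Pow T" "finite T"
  shows "xor_affine {v\<in>V. dot u v = b}"
proof -
  have "finite x" if "x \<in> V" for x
    using assms that finite_subset by blast
  then show ?thesis
    using assms(1) by (auto simp: xor_affine_def dot_sym_diff)
qed

text \<open>Adding the sum of \<open>a\<close> and \<open>b\<close> flips the inner product with
  \<open>u\<close>, so this involution of \<open>V\<close> exchanges the two level sets.\<close>

lemma card_level_sets_eq:
  assumes aff: "xor_affine V" and V: "V \<subseteq> Pow T" and T: "finite T"
    and a: "a \<in> V" "dot u a" and b: "b \<in> V" "\<not> dot u b"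
  shows "card {v\<in>V. dot u v} = card {v\<in>V. \<not> dot u v}"
proof -
  let ?f = "\<lambda>x. sym_diff a (sym_diff b x)"
  have fin: "finite x" if "x \<in> V" for x
    using V T that finite_subset by blast
  have inv: "?f (?f x) = x" for x by blast
  have fV: "?f x \<in> V" if "x \<in> V" for x
    using aff a(1) b(1) that unfolding xor_affine_def by blast
  have dotf: "dot u (?f x) \<longleftrightarrow> \<not> dot u x" if "x \<in> V" for x
    using fin a b that by (simp add: dot_sym_diff)
  show ?thesis
    by (rule bij_betw_same_card [of ?f], rule bij_betw_byWitness [where f' = ?f])
      (use inv fV dotf in blast)+
qed

lemma card_level_set_half:
  assumes "xor_affine V" "V \<subseteq> Pow T" "finite T"
    and "a \<in> V" "dot u a" "b \<in> V" "\<not> dot u b"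
  shows "2 * card {v\<in>V. dot u v = c} = card V"
proof -
  have fin: "finite V" using assms(2,3) finite_subset by blast
  have "{v\<in>V. dot u v} \<union> {v\<in>V. \<not> dot u v} = V" by blast
  moreover have "card ({v\<in>V. dot u v} \<union> {v\<in>V. \<not> dot u v}) = card {v\<in>V. dot u v} + card {v\<in>V. \<not> dot u v}"
    by (rule card_Un_disjoint) (use fin in auto)
  ultimately show ?thesis using card_level_sets_eq [OF assms]
    by (cases c) auto
qed

lemma card_dot_half:
  assumes "u \<subseteq> T" "u \<noteq> {}" "finite T"
  shows "2 * card {v\<in>Pow T. dot u v = c} = 2 ^ card T"
proof -
  obtain a where a: "a \<in> u" using assms by blast
  then have "u \<inter> {a} = {a}" by blast
  then have "dot u {a}" by (simp add: dot_def)
  then show ?thesis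
    using card_level_set_half [OF xor_affine_Pow, of T T "{a}" u "{}" c] a assms
    by (auto simp: card_Pow)
qed

section \<open>Orthogonality of characters and Lindsey's lemma\<close>

definition sg :: "nat set \<Rightarrow> nat set \<Rightarrow> int" where
  "sg u v = (if dot u v then -1 else 1)"

text \<open>The product of the two signs is the character of the sum of \<open>v\<close> and
  \<open>w\<close>, which is balanced on \<open>Pow T\<close> unless that sum is zero.\<close>

lemma sum_sg_sg:
  assumes "v \<subseteq> T" "w \<subseteq> T" "finite T"
  shows "(\<Sum>u\<in>Pow T. sg u v * sg u w) = (if v = w then 2 ^ card T else 0)"
proof (cases "v = w")
  case True
  then show ?thesis using assms by (simp add: sg_def card_Pow if_distrib cong: if_cong)
next
  case False
  define z where "z = sym_diff v w"
  have z: "z \<subseteq> T" "z \<noteq> {}" using assms False by (auto simp: z_def)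
  have fin: "finite v" "finite w" using assms finite_subset by auto
  have "(\<Sum>u\<in>Pow T. sg u v * sg u w) = (\<Sum>u\<in>Pow T. if dot z u then -1 else 1)"
    by (rule sum.cong) (use fin in \<open>auto simp: sg_def z_def dot_commute [of "_ \<union> _"] dot_sym_diff\<close>)
  also have "\<dots> = - int (card {u\<in>Pow T. dot z u}) + int (card {u\<in>Pow T. \<not> dot z u})"
    using assms(3) by (subst sum.If_cases) (auto simp: Int_def)
  also have "\<dots> = 0"
    using card_dot_half [OF z assms(3), of True] card_dot_half [OF z assms(3), of False] by simp
  finally show ?thesis using False by simp
qed

text \<open>A case of Lindsey's lemma: the second moment over \<open>u\<close> of the character sum
  \<open>\<Sum>v\<in>V. sg u v\<close> is \<open>card V * 2 ^ card T\<close> by orthogonality.\<close>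

lemma card_constant_mult_le:
  assumes "V \<subseteq> Pow T" "finite T"
  shows "card {u\<in>Pow T. \<forall>v\<in>V. dot u v} * card V \<le> 2 ^ card T"
proof (cases "V = {}")
  case False
  let ?M = "{u\<in>Pow T. \<forall>v\<in>V. dot u v}"
  have fin: "finite V" using assms finite_subset by blast
  \<comment> \<open>For \<open>u\<close> in \<open>?M\<close> all signs are -1, so nothing cancels
    in the inner sum.\<close>
  have "(\<Sum>u\<in>?M. (\<Sum>v\<in>V. sg u v)\<^sup>2) = (\<Sum>u\<in>?M. (int (card V))\<^sup>2)"
    by (rule sum.cong) (auto simp: sg_def)
  then have "int (card ?M) * (int (card V))\<^sup>2 = (\<Sum>u\<in>?M. (\<Sum>v\<in>V. sg u v)\<^sup>2)"
    by simp
  also have "\<dots> \<le> (\<Sum>u\<in>Pow T. (\<Sum>v\<in>V. sg u v)\<^sup>2)"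
    by (rule sum_mono2) (use assms in auto)
  also have "\<dots> = (\<Sum>u\<in>Pow T. \<Sum>v\<in>V. \<Sum>w\<in>V. sg u v * sg u w)"
    by (simp add: power2_eq_square sum_product)
  also have "\<dots> = (\<Sum>v\<in>V. \<Sum>u\<in>Pow T. \<Sum>w\<in>V. sg u v * sg u w)"
    by (rule sum.swap)
  also have "\<dots> = (\<Sum>v\<in>V. \<Sum>w\<in>V. \<Sum>u\<in>Pow T. sg u v * sg u w)"
    by (rule sum.cong [OF refl]) (rule sum.swap)
  also have "\<dots> = (\<Sum>v\<in>V. \<Sum>w\<in>V. if v = w then 2 ^ card T else 0)"
    by (intro sum.cong refl sum_sg_sg) (use assms in auto)
  also have "\<dots> = int (card V) * 2 ^ card T"
    using fin by simp
  finally have "int (card V) * (int (card ?M) * int (card V)) \<le> int (card V) * 2 ^ card T"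
    by (simp add: power2_eq_square mult_ac)
  moreover have "0 < int (card V)" using False fin by (simp add: card_gt_0_iff)
  ultimately have "int (card ?M) * int (card V) \<le> 2 ^ card T"
    by (simp only: mult_le_cancel_left_pos)
  then have "int (card ?M * card V) \<le> int (2 ^ card T)" by simp
  then show ?thesis by (simp only: of_nat_le_iff)
qed simp

section \<open>Sequences of vector pairs: counting chains, bounding triangular ones\<close>

abbreviation odd_part :: "nat set set \<Rightarrow> nat set \<Rightarrow> nat set set" where
  "odd_part V u \<equiv> {v\<in>V. dot u v}"

text \<open>The first argument is the set of second components still admissible; each chosen first
  component cuts it down to the vectors having inner product 1 with it.\<close>

primrec chained :: "nat set set \<Rightarrow> (nat set \<times> nat set) list \<Rightarrow> bool" where
  "chained V [] \<longleftrightarrow> True"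
| "chained V (p # ps) \<longleftrightarrow> snd p \<in> odd_part V (fst p) \<and> chained (odd_part V (fst p)) ps"

definition chain_lists :: "nat \<Rightarrow> nat set set \<Rightarrow> nat \<Rightarrow> (nat set \<times> nat set) list set" where
  "chain_lists t V m = {ps. length ps = m \<and> fst ` set ps \<subseteq> Pow {..<t} \<and> chained V ps}"

lemma chained_if_sorted_wrt:
  assumes "sorted_wrt (\<lambda>p q. dot (fst p) (snd q)) ps"
    and "\<And>p. p \<in> set ps \<Longrightarrow> dot (fst p) (snd p) \<and> snd p \<in> V"
  shows "chained V ps"
  using assms by (induction ps arbitrary: V) auto

text \<open>Peeling off the first pair turns the count into a sum over \<open>u\<close>, with the
  recursion restarting on \<open>odd_part V u\<close>.\<close>

lemma chain_lists_Suc: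
  "chain_lists t V (Suc m) =
    (\<lambda>(u, v, ps). (u, v) # ps) `
      (SIGMA u:Pow {..<t}. odd_part V u \<times> chain_lists t (odd_part V u) m)"
  unfolding chain_lists_def by (force simp: length_Suc_conv image_iff)

lemma finite_chain_lists:
  assumes "finite V"
  shows "finite (chain_lists t V m)"
  using assms
proof (induction m arbitrary: V)
  case 0
  have "chain_lists t V 0 = {[]}" by (auto simp: chain_lists_def)
  then show ?case by simp
next
  case (Suc m)
  then show ?case unfolding chain_lists_Suc by (intro finite_imageI finite_SigmaI) auto
qed

text \<open>The worst sequences halve the set of admissible \<open>v\<close> at every step.\<close>

lemma card_chain_lists_le:
  assumes "V \<subseteq> Pow {..<t}" "xor_affine V" "card V \<le> 2 ^ e"
  shows "card (chain_lists t V m) \<le> 2 ^ (t * m + m + (\<Sum>j<m. e - Suc j))"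
  using assms
proof (induction m arbitrary: V e)
  case 0
  have "chain_lists t V 0 = {[]}" by (auto simp: chain_lists_def)
  then show ?case by simp
next
  case (Suc m)
  let ?P = "Pow {..<t}"
  \<comment> \<open>The target exponent is \<open>?C + t + 1\<close>: the \<open>t\<close> pays for
    the choice of \<open>u\<close>, the 1 for the split into \<open>M\<close> and its
    complement.\<close>
  let ?C = "t * m + m + (\<Sum>j<Suc m. e - Suc j)"
  let ?g = "\<lambda>u. card (odd_part V u) * card (chain_lists t (odd_part V u) m)"
  define M where "M = {u\<in>?P. \<forall>v\<in>V. dot u v}"
  have finV: "finite V" using Suc.prems(1) finite_subset by blast
  have "card (chain_lists t V (Suc m)) \<le> card (SIGMA u:?P. odd_part V u \<times> chain_lists t (odd_part V u) m)"
    unfolding chain_lists_Suc by (intro card_image_le finite_SigmaI finite_cartesian_product finite_chain_lists)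
      (use finV in auto)
  also have "\<dots> = (\<Sum>u\<in>?P. ?g u)"
    using finV by (subst card_SigmaI) (simp_all add: card_cartesian_product finite_chain_lists)
  also have "\<dots> = (\<Sum>u\<in>M. ?g u) + (\<Sum>u\<in>?P - M. ?g u)"
    by (subst sum.subset_diff [of M]) (auto simp: M_def)
  also have "\<dots> \<le> 2 ^ t * 2 ^ ?C + 2 ^ t * 2 ^ ?C"
  proof (rule add_mono)
    \<comment> \<open>Here the admissible set does not shrink, but by Lindsey's lemma a single
      factor \<open>2 ^ t\<close> pays for \<open>u\<close> and \<open>v\<close> together.\<close>
    have "odd_part V u = V" if "u \<in> M" for u
      using that by (auto simp: M_def)
    then have "(\<Sum>u\<in>M. ?g u) = card M * card V * card (chain_lists t V m)"
      by simp
    also have "\<dots> \<le> 2 ^ t * 2 ^ ?C"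
    proof (rule mult_mono)
      show "card M * card V \<le> 2 ^ t"
        using card_constant_mult_le [OF Suc.prems(1)] by (simp add: M_def)
      have "card (chain_lists t V m) \<le> 2 ^ (t * m + m + (\<Sum>j<m. e - Suc j))"
        using Suc by blast
      also have "\<dots> \<le> 2 ^ ?C"
        by (rule power_increasing) auto
      finally show "card (chain_lists t V m) \<le> 2 ^ ?C" .
    qed auto
    finally show "(\<Sum>u\<in>M. ?g u) \<le> 2 ^ t * 2 ^ ?C" .
  next
    have "?g u \<le> 2 ^ ?C" if "u \<in> ?P - M" for u
    proof (cases "odd_part V u = {}")
      \<comment> \<open>A \<open>u\<close> orthogonal to all of \<open>V\<close> leaves no
        admissible \<open>v\<close>.\<close>
      case True
      then show ?thesis by (simp only: card.empty mult_0)
    next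
      case False
      then obtain a b where ab: "a \<in> V" "dot u a" "b \<in> V" "\<not> dot u b"
        using \<open>u \<in> ?P - M\<close> by (auto simp: M_def)
      have half: "2 * card (odd_part V u) = card V"
        using card_level_set_half [OF Suc.prems(2,1) _ ab, of True] by simp
      \<comment> \<open>Two elements in \<open>V\<close> force \<open>e\<close> to be positive, so
        halving really lowers the exponent by one.\<close>
      have "card {a, b} \<le> card V"
        using ab finV by (intro card_mono) auto
      moreover have "a \<noteq> b" using ab by blast
      ultimately have "2 \<le> card V" by simp
      with Suc.prems(3) obtain e' where e: "e = Suc e'"
        by (cases e) auto
      have le: "card (odd_part V u) \<le> 2 ^ e'"
        using half Suc.prems(3) e by simp
      have "card (chain_lists t (odd_part V u) m) \<le> 2 ^ (t * m + m + (\<Sum>j<m. e' - Suc j))"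
        by (rule Suc.IH [OF _ _ le])
          (use Suc.prems xor_affine_level_set [OF Suc.prems(2,1), of u True] in auto)
      with le have "?g u \<le> 2 ^ e' * 2 ^ (t * m + m + (\<Sum>j<m. e' - Suc j))"
        by (rule mult_mono) auto
      \<comment> \<open>The choice of \<open>v\<close> supplies the summand for
        \<open>j = 0\<close>; the induction hypothesis supplies the others, shifted by one.\<close>
      also have "\<dots> = 2 ^ ?C"
        by (simp only: e sum.lessThan_Suc_shift power_add [symmetric]) (simp add: ac_simps)
      finally show ?thesis .
    qed
    then have "(\<Sum>u\<in>?P - M. ?g u) \<le> of_nat (card (?P - M)) * 2 ^ ?C"
      by (rule sum_bounded_above)
    also have "\<dots> \<le> 2 ^ t * 2 ^ ?C"
      using card_mono [of ?P "?P - M"] by (intro mult_mono) (auto simp: card_Pow)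
    finally show "(\<Sum>u\<in>?P - M. ?g u) \<le> 2 ^ t * 2 ^ ?C" .
  qed
  also have "\<dots> = 2 ^ (t * Suc m + Suc m + (\<Sum>j<Suc m. e - Suc j))"
    by (simp add: power_add)
  finally show ?case .
qed

text \<open>A matrix over the two-element field that is triangular with ones on the diagonal has
  full rank.\<close>

lemma triangular_length_le:
  assumes "sorted_wrt (\<lambda>p q. \<not> dot (fst p) (snd q)) ps"
    and "\<And>p. p \<in> set ps \<Longrightarrow> dot (fst p) (snd p) \<and> snd p \<in> V"
    and "V \<subseteq> Pow {..<t}" "xor_affine V" "{} \<in> V"
  shows "2 ^ length ps \<le> card V"
  using assms
proof (induction ps arbitrary: V)
  case Nil
  have "finite V" using Nil finite_subset by blast
  then show ?case using Nil by (auto simp: Suc_le_eq card_gt_0_iff)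
next
  case (Cons p ps)
  let ?W = "{v\<in>V. dot (fst p) v = False}"
  have "2 ^ length ps \<le> card ?W"
  proof (rule Cons.IH)
    show "xor_affine ?W"
      by (rule xor_affine_level_set) (use Cons.prems in auto)
  qed (use Cons.prems in auto)
  \<comment> \<open>The vectors \<open>snd p\<close> and \<open>{}\<close> show that
    \<open>fst p\<close> is not constant on \<open>V\<close>, so each pair of the list halves the
    subspace containing the later second components.\<close>
  moreover have "2 * card ?W = card V"
    by (rule card_level_set_half [where a = "snd p" and b = "{}"]) (use Cons.prems in auto)
  ultimately show ?case by simp
qed

section \<open>The sample space and the union bound\<close>

definition pairs :: "nat \<Rightarrow> (nat set \<times> nat set) set" where
  "pairs t = {(u, v). u \<subseteq> {..<t} \<and> v \<subseteq> {..<t} \<and> dot u v}"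

lemma finite_pairs: "finite (pairs t)"
  by (rule finite_subset [of _ "Pow {..<t} \<times> Pow {..<t}"]) (auto simp: pairs_def)

text \<open>Each nonempty \<open>u\<close> has \<open>2 ^ (t - 1)\<close> partners, and there are
  \<open>2 ^ t - 1\<close> such \<open>u\<close>; rounding the latter down to
  \<open>2 ^ (t - 1)\<close> gives a power of two.\<close>

lemma card_pairs_ge:
  assumes "t \<ge> 1"
  shows "2 ^ (2 * t - 2) \<le> card (pairs t)"
proof -
  let ?P = "Pow {..<t} - {{}}"
  have half: "card (odd_part (Pow {..<t}) u) = 2 ^ (t - 1)" if "u \<in> ?P" for u
  proof -
    have "2 * card (odd_part (Pow {..<t}) u) = 2 * 2 ^ (t - 1)"
      using card_dot_half [of u "{..<t}" True] that assms
      by (simp flip: power_Suc)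
    then show ?thesis by simp
  qed
  have "(2::nat) ^ (2 * t - 2) = 2 ^ (t - 1) * 2 ^ (t - 1)"
    by (simp add: mult_2 algebra_simps flip: power_add)
  also have "\<dots> \<le> card ?P * 2 ^ (t - 1)"
  proof (rule mult_right_mono)
    have "(2::nat) ^ t = 2 * 2 ^ (t - 1)" using assms by (simp flip: power_Suc)
    moreover have "(1::nat) \<le> 2 ^ (t - 1)" by simp
    ultimately have "(2::nat) ^ (t - 1) \<le> 2 ^ t - 1" by linarith
    then show "2 ^ (t - 1) \<le> card ?P"
      by (simp add: card_Diff_singleton card_Pow)
  qed simp
  also have "\<dots> = (\<Sum>u\<in>?P. card (odd_part (Pow {..<t}) u))"
    by (subst sum.cong [OF refl half]) auto
  also have "\<dots> = card (SIGMA u:?P. odd_part (Pow {..<t}) u)"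
    by (subst card_SigmaI) auto
  also have "\<dots> \<le> card (pairs t)"
    by (rule card_mono [OF finite_pairs]) (auto simp: pairs_def)
  finally show ?thesis .
qed

text \<open>A union bound by counting: a fixed \<open>K\<close> is bad when all \<open>k\<close> of
  its lists lie in \<open>D\<close>, which for independent uniform values has probability at most
  \<open>(card D / card A ^ s) ^ k\<close>.\<close>

lemma exists_avoiding_assignment:
  fixes A :: "'a set" and D :: "'a list set"
  assumes "finite A" "A \<noteq> {}" "finite D"
    and less: "(n choose s) * card D ^ k < card A ^ (s * k)"
  obtains (avoids) f where "f \<in> {..<k} \<times> {..<n} \<rightarrow>\<^sub>E A"
    and "\<And>K. K \<subseteq> {..<n} \<Longrightarrow> card K = s \<Longrightarrow>
      \<exists>i<k. map (\<lambda>x. f (i, x)) (sorted_list_of_set K) \<notin> D"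
proof (rule ccontr)
  define F where "F = {..<k} \<times> {..<n} \<rightarrow>\<^sub>E A"
  define B where "B K = {f\<in>F. \<forall>i<k. map (\<lambda>x. f (i, x)) (sorted_list_of_set K) \<in> D}" for K
  assume "\<not> thesis"
  have bad: "\<exists>K. K \<subseteq> {..<n} \<and> card K = s \<and> f \<in> B K" if "f \<in> F" for f
  proof (rule ccontr)
    assume "\<not> ?thesis"
    then have "\<exists>i<k. map (\<lambda>x. f (i, x)) (sorted_list_of_set K) \<notin> D"
      if "K \<subseteq> {..<n}" "card K = s" for K
      using \<open>f \<in> F\<close> that unfolding B_def by blast
    then show False
      using avoids [of f] \<open>f \<in> F\<close> \<open>\<not> thesis\<close> unfolding F_def by blast
  qed
  have card_F: "card F = card A ^ (k * n)"
    by (simp add: F_def card_PiE)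
  have fin_F: "finite F"
    unfolding F_def by (intro finite_PiE) (use assms in auto)
  have card_B: "card (B K) \<le> card D ^ k * card A ^ (k * (n - s))" if K: "K \<subseteq> {..<n}" "card K = s" for K
  proof -
    let ?R = "{..<k} \<times> ({..<n} - K)"
    let ?T = "({..<k} \<rightarrow>\<^sub>E D) \<times> (?R \<rightarrow>\<^sub>E A)"
    \<comment> \<open>The lists along \<open>K\<close> determine \<open>f\<close> on
      \<open>K\<close>, and the restriction determines it elsewhere, so this encoding is
      injective.\<close>
    define \<Phi> where "\<Phi> f = (\<lambda>i\<in>{..<k}. map (\<lambda>x. f (i, x)) (sorted_list_of_set K), restrict f ?R)"
      for f :: "nat \<times> nat \<Rightarrow> 'a"
    have finK: "finite K" using K finite_subset by blast
    have "inj_on \<Phi> F"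
    proof (rule inj_onI)
      fix f g assume fg: "f \<in> F" "g \<in> F" and eq: "\<Phi> f = \<Phi> g"
      show "f = g"
      proof (rule PiE_ext)
        show "f \<in> {..<k} \<times> {..<n} \<rightarrow>\<^sub>E A" "g \<in> {..<k} \<times> {..<n} \<rightarrow>\<^sub>E A"
          using fg by (auto simp: F_def)
        fix z assume "z \<in> {..<k} \<times> {..<n}"
        then obtain i x where z: "z = (i, x)" "i < k" "x < n" by auto
        show "f z = g z"
        proof (cases "x \<in> K")
          case True
          have "fst (\<Phi> f) i = fst (\<Phi> g) i" using eq by simp
          then show ?thesis using z True finK by (simp add: \<Phi>_def)
        next
          case False
          have "snd (\<Phi> f) z = snd (\<Phi> g) z" using eq by simp
          then show ?thesis using z False by (simp add: \<Phi>_def)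
        qed
      qed
    qed
    then have "inj_on \<Phi> (B K)" by (rule inj_on_subset) (auto simp: B_def)
    moreover have "\<Phi> ` B K \<subseteq> ?T"
      by (auto simp: \<Phi>_def B_def F_def PiE_iff split: if_splits)
    moreover have "finite ?T"
      by (intro finite_cartesian_product finite_PiE) (use assms in auto)
    ultimately have "card (B K) \<le> card ?T" by (rule card_inj_on_le)
    also have "\<dots> = card D ^ k * card A ^ (k * (n - s))"
      using K finK by (simp add: card_cartesian_product card_PiE card_Diff_subset)
    finally show ?thesis .
  qed
  have "F \<subseteq> (\<Union>K\<in>[{..<n}]\<^bsup>s\<^esup>. B K)"
  proof
    fix f assume "f \<in> F"
    then obtain K where K: "K \<subseteq> {..<n}" "card K = s" "f \<in> B K" using bad by blast
    moreover have "finite K" using K(1) by (rule finite_subset) simp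
    ultimately show "f \<in> (\<Union>K\<in>[{..<n}]\<^bsup>s\<^esup>. B K)" by (auto simp: nsets_def)
  qed
  then have "card F \<le> card (\<Union>K\<in>[{..<n}]\<^bsup>s\<^esup>. B K)"
    by (rule card_mono [rotated]) (use fin_F in \<open>auto simp: B_def finite_imp_finite_nsets\<close>)
  also have "\<dots> \<le> (\<Sum>K\<in>[{..<n}]\<^bsup>s\<^esup>. card (B K))"
    by (rule card_UN_le) (simp add: finite_imp_finite_nsets)
  also have "\<dots> \<le> of_nat (card ([{..<n}]\<^bsup>s\<^esup>)) * (card D ^ k * card A ^ (k * (n - s)))"
    by (rule sum_bounded_above) (simp add: nsets_def card_B)
  also have "\<dots> = ((n choose s) * card D ^ k) * card A ^ (k * (n - s))"
    by (simp add: mult_ac)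
  finally have le: "card A ^ (k * n) \<le> ((n choose s) * card D ^ k) * card A ^ (k * (n - s))"
    by (simp add: card_F)
  have pos: "0 < card A" using assms by (simp add: card_gt_0_iff)
  show False
  proof (cases "s \<le> n")
    \<comment> \<open>Only for \<open>s \<le> n\<close> is \<open>n - s\<close> a true difference;
      otherwise the binomial coefficient vanishes and \<open>le\<close> is already absurd.\<close>
    case True
    have "((n choose s) * card D ^ k) * card A ^ (k * (n - s)) < card A ^ (s * k) * card A ^ (k * (n - s))"
      using less pos by simp
    also have "\<dots> = card A ^ (k * n)"
    proof -
      have "s * k + k * (n - s) = k * (s + (n - s))" by (simp add: distrib_left mult.commute)
      also have "\<dots> = k * n" using True by simp
      finally show ?thesis by (simp flip: power_add)
    qed
    finally show False using le by simp
  next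
    case False
    then show False using le pos by (simp add: binomial_eq_0)
  qed
qed

section \<open>The colouring and its cliques\<close>

definition first_even :: "nat \<Rightarrow> (nat \<times> nat \<Rightarrow> nat set \<times> nat set) \<Rightarrow> nat set \<Rightarrow> nat" where
  "first_even k f e = (LEAST i. i = k \<or> \<not> dot (fst (f (i, Min e))) (snd (f (i, Max e))))"

lemma first_even_le: "first_even k f e \<le> k"
  unfolding first_even_def by (rule Least_le) simp

text \<open>The disjunct \<open>i = k\<close> ensures that a least index exists: a value below
  \<open>k\<close> satisfies the other disjunct, and the value \<open>k\<close> means that every
  smaller index failed it.\<close>

lemma first_even_less_iff_dot:
  assumes "x < y" "i < k"
  shows "first_even k f {x, y} = i \<Longrightarrow> \<not> dot (fst (f (i, x))) (snd (f (i, y)))"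
    and "first_even k f {x, y} = k \<Longrightarrow> dot (fst (f (i, x))) (snd (f (i, y)))"
proof -
  let ?P = "\<lambda>i. i = k \<or> \<not> dot (fst (f (i, x))) (snd (f (i, y)))"
  \<comment> \<open>\<open>Min\<close> and \<open>Max\<close> recover the order of the ends from the
    unordered edge.\<close>
  have eq: "first_even k f {x, y} = (LEAST i. ?P i)"
    using assms by (simp add: first_even_def max_def min_def)
  show "\<not> dot (fst (f (i, x))) (snd (f (i, y)))" if "first_even k f {x, y} = i"
    using LeastI [of ?P k] that assms by (auto simp: eq)
  show "dot (fst (f (i, x))) (snd (f (i, y)))" if "first_even k f {x, y} = k"
    using not_less_Least [of i ?P] that assms by (auto simp: eq)
qed

text \<open>Colours below \<open>k\<close> are free of large cliques for every assignment of pairs,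
  by the rank bound; only colour \<open>k\<close> relies on the union bound.\<close>

lemma exists_colouring:
  assumes "t \<ge> 1"
    and less: "(n choose Suc t) * card (chain_lists t (Pow {..<t}) (Suc t)) ^ k < card (pairs t) ^ (Suc t * k)"
  obtains c where "edge_colouring n (Suc k) c"
    and "\<And>K. K \<subseteq> {..<n} \<Longrightarrow> card K = Suc t \<Longrightarrow> \<not> Defs.monochromatic c K"
proof -
  let ?D = "chain_lists t (Pow {..<t}) (Suc t)"
  have "(0::nat) < 2 ^ (2 * t - 2)" by simp
  then have "pairs t \<noteq> {}" using card_pairs_ge [OF assms(1)] by fastforce
  then obtain f where f: "f \<in> {..<k} \<times> {..<n} \<rightarrow>\<^sub>E pairs t"
    and avoid: "\<And>K. K \<subseteq> {..<n} \<Longrightarrow> card K = Suc t \<Longrightarrow>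
      \<exists>i<k. map (\<lambda>x. f (i, x)) (sorted_list_of_set K) \<notin> ?D"
    using exists_avoiding_assignment [OF finite_pairs _ _ less]
    by (metis finite_Pow_iff finite_chain_lists finite_lessThan)
  have "\<not> Defs.monochromatic (first_even k f) K" if K: "K \<subseteq> {..<n}" "card K = Suc t" for K
  proof
    assume "Defs.monochromatic (first_even k f) K"
    then obtain i where i: "first_even k f {x, y} = i" if "x \<in> K" "y \<in> K" "x \<noteq> y" for x y
      by (auto simp: Defs.monochromatic_def)
    have finK: "finite K" using K finite_subset by blast
    \<comment> \<open>Two distinct vertices are required to know that \<open>i\<close> is a colour
      actually taken, hence at most \<open>k\<close>.\<close>
    have "\<not> card K \<le> Suc 0" using K assms(1) by simp
    then obtain x y where "x \<in> K" "y \<in> K" "x \<noteq> y"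
      using finK by (auto simp: card_le_Suc0_iff_eq)
    then have "i \<le> k" using i first_even_le [of k f "{x, y}"] by auto
    let ?ps = "\<lambda>j. map (\<lambda>x. f (j, x)) (sorted_list_of_set K)"
    have pairs: "p \<in> pairs t" if "p \<in> set (?ps j)" "j < k" for p j
      using that f K finK by (auto simp: PiE_iff)
    have wrt: "sorted_wrt (\<lambda>p q. P (fst p) (snd q)) (?ps j)"
      if "\<And>x y. x \<in> K \<Longrightarrow> y \<in> K \<Longrightarrow> x < y \<Longrightarrow> P (fst (f (j, x))) (snd (f (j, y)))" for P j
      unfolding sorted_wrt_map
      by (rule sorted_wrt_mono_rel [OF _ strict_sorted_list_of_set]) (use that finK in auto)
    show False
    proof (cases "i < k")
      case True
      have "2 ^ length (?ps i) \<le> card (Pow {..<t})"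
      proof (rule triangular_length_le)
        show "sorted_wrt (\<lambda>p q. \<not> dot (fst p) (snd q)) (?ps i)"
          by (rule wrt) (use True i first_even_less_iff_dot(1) in fastforce)
        show "dot (fst p) (snd p) \<and> snd p \<in> Pow {..<t}" if "p \<in> set (?ps i)" for p
          using pairs [OF that True] by (auto simp: pairs_def)
      qed (auto intro: xor_affine_Pow)
      \<comment> \<open>The bound reads \<open>2 ^ (t + 1) \<le> 2 ^ t\<close>.\<close>
      then show False using K by (simp add: card_Pow)
    next
      case False
      with \<open>i \<le> k\<close> have [simp]: "i = k" by simp
      have "?ps j \<in> ?D" if "j < k" for j
      proof -
        have "chained (Pow {..<t}) (?ps j)"
        proof (rule chained_if_sorted_wrt)
          show "sorted_wrt (\<lambda>p q. dot (fst p) (snd q)) (?ps j)"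
            by (rule wrt) (use that i first_even_less_iff_dot(2) in fastforce)
          show "dot (fst p) (snd p) \<and> snd p \<in> Pow {..<t}" if "p \<in> set (?ps j)" for p
            using pairs [OF that \<open>j < k\<close>] by (auto simp: pairs_def)
        qed
        moreover have "fst ` set (?ps j) \<subseteq> Pow {..<t}"
          using pairs [OF _ that] by (fastforce simp: pairs_def)
        ultimately show ?thesis using K by (simp add: chain_lists_def)
      qed
      then show False using avoid [OF K] by blast
    qed
  qed
  moreover have "edge_colouring n (Suc k) (first_even k f)"
    by (simp add: edge_colouring_def first_even_le less_Suc_eq_le)
  ultimately show thesis using that by blast
qed

section \<open>From colourings to the Ramsey number\<close>

lemma ramsey_number_arrows:
  assumes "edge_colouring (ramsey_number s l) l c"
  shows "\<exists>K \<subseteq> {..<ramsey_number s l}. card K = s \<and> Defs.monochromatic c K"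
proof -
  \<comment> \<open>Ramsey's theorem provides some \<open>N\<close> with the defining property, so
    the \<open>LEAST\<close> is attained.\<close>
  obtain N :: nat where N: "partn_lst {..<N} (replicate l s) 2"
    using ramsey_full by blast
  have "\<forall>c. edge_colouring N l c \<longrightarrow> (\<exists>K \<subseteq> {..<N}. card K = s \<and> Defs.monochromatic c K)"
  proof (intro allI impI)
    fix c assume c: "edge_colouring N l c"
    have "c \<in> [{..<N}]\<^bsup>2\<^esup> \<rightarrow> {..<l}"
      using c by (auto simp: edge_colouring_def nsets_2_eq)
    then obtain i H where "i < length (replicate l s)" "H \<in> [{..<N}]\<^bsup>(replicate l s ! i)\<^esup>"
      and H: "c ` [H]\<^bsup>2\<^esup> \<subseteq> {i}"
      by (rule partn_lstE [OF N]) simp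
    then have "H \<subseteq> {..<N}" "card H = s" by (auto simp: nsets_def)
    moreover have "Defs.monochromatic c H"
      unfolding Defs.monochromatic_def
      by (rule exI [of _ i]) (use H in \<open>auto simp: image_subset_iff\<close>)
    ultimately show "\<exists>K \<subseteq> {..<N}. card K = s \<and> Defs.monochromatic c K" by blast
  qed
  from LeastI [where P = "\<lambda>N. \<forall>c. edge_colouring N l c \<longrightarrow>
      (\<exists>K \<subseteq> {..<N}. card K = s \<and> Defs.monochromatic c K)", OF this] assms
  show ?thesis unfolding ramsey_number_def by blast
qed

text \<open>For a smaller \<open>n\<close> the count of bad assignments is below the total, and the
  resulting colouring contradicts the defining property of the Ramsey number.\<close>

lemma ramsey_number_ge:
  assumes "t \<ge> 1"
  shows "2 powr (real k * (real (Suc t) / 2 - 4)) \<le> real (ramsey_number (Suc t) (Suc k))"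
proof (rule ccontr)
  define n where "n = ramsey_number (Suc t) (Suc k)"
  define D where "D = chain_lists t (Pow {..<t}) (Suc t)"
  define E where "E = t * Suc t + Suc t + (\<Sum>j<Suc t. t - Suc j)"
  assume "\<not> ?thesis"
  then have n: "real n < 2 powr (real k * (real (Suc t) / 2 - 4))"
    by (simp add: n_def)
  \<comment> \<open>The summand for \<open>j = t\<close> is 0 by truncated subtraction; the others
    run through \<open>t - 1\<close> down to 0.\<close>
  have "(\<Sum>j<Suc t. t - Suc j) = (\<Sum>j<t. j)"
    using sum.nat_diff_reindex [of "\<lambda>j. j" t] by simp
  moreover have "2 * (\<Sum>j<t. real j) = real t * (real t - 1)"
    by (induction t) (auto simp: algebra_simps)
  ultimately have E: "real E = real t * (real t + 1) + (real t + 1) + real t * (real t - 1) / 2"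
    by (simp add: E_def algebra_simps del: sum.lessThan_Suc)
  have "card D \<le> 2 ^ E"
    unfolding D_def E_def by (rule card_chain_lists_le) (auto simp: card_Pow xor_affine_Pow)
  then have "real (card D) \<le> 2 ^ E"
    using of_nat_mono by fastforce
  then have cardD: "real (card D ^ k) \<le> 2 powr (real k * real E)"
    using power_mono [of "real (card D)" "2 ^ E" k]
    by (simp add: powr_realpow mult.commute flip: power_mult of_nat_mult)
  have "real (n choose Suc t) \<le> real n ^ Suc t"
  proof (cases "Suc t \<le> n")
    case True
    then have "real (n choose Suc t) \<le> real (n ^ Suc t)"
      by (simp only: of_nat_le_iff binomial_le_pow)
    then show ?thesis by simp
  qed (simp add: binomial_eq_0)
  also have "\<dots> < (2 powr (real k * (real (Suc t) / 2 - 4))) ^ Suc t"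
    by (rule power_strict_mono) (use n in auto)
  also have "\<dots> = 2 powr (real (Suc t) * (real k * (real (Suc t) / 2 - 4)))"
    by (subst powr_realpow [symmetric]) (simp_all add: powr_powr mult.commute del: of_nat_Suc)
  finally have less: "real (n choose Suc t) < 2 powr (real (Suc t) * (real k * (real (Suc t) / 2 - 4)))" .
  have "real ((n choose Suc t) * card D ^ k) <
      2 powr (real (Suc t) * (real k * (real (Suc t) / 2 - 4))) * 2 powr (real k * real E)"
    unfolding of_nat_mult
    by (rule le_less_trans [OF mult_left_mono [OF cardD] mult_strict_right_mono [OF less]]) simp_all
  also have "\<dots> = 2 powr (real k * (real (Suc t) * (real (Suc t) / 2 - 4) + real E))"
    by (simp add: algebra_simps flip: powr_add)
  \<comment> \<open>With \<open>s = t + 1\<close> and the factor \<open>k\<close> removed, the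
    exponents are \<open>2 s^2 - 11 s / 2 + 1\<close> and \<open>2 s^2 - 4 s\<close>; subtracting 4
    from \<open>s / 2\<close> absorbs the linear terms.\<close>
  also have "\<dots> \<le> 2 powr (real k * (real (Suc t) * (2 * real t - 2)))"
    by (intro powr_mono mult_left_mono) (auto simp: E field_simps)
  also have "\<dots> = (2 ^ (2 * t - 2)) ^ (Suc t * k)"
    using assms by (simp add: powr_realpow [symmetric] powr_powr algebra_simps)
  also have "\<dots> \<le> real (card (pairs t)) ^ (Suc t * k)"
  proof (rule power_mono)
    have "real (2 ^ (2 * t - 2)) \<le> real (card (pairs t))"
      using card_pairs_ge [OF assms] by (simp only: of_nat_le_iff)
    then show "2 ^ (2 * t - 2) \<le> real (card (pairs t))" by simp
  qed simp
  also have "\<dots> = real (card (pairs t) ^ (Suc t * k))" by simp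
  finally have "(n choose Suc t) * card D ^ k < card (pairs t) ^ (Suc t * k)"
    by (simp only: of_nat_less_iff)
  then obtain c where "edge_colouring n (Suc k) c"
    and "\<And>K. K \<subseteq> {..<n} \<Longrightarrow> card K = Suc t \<Longrightarrow> \<not> Defs.monochromatic c K"
    using exists_colouring [OF assms] unfolding D_def by metis
  then show False
    using ramsey_number_arrows unfolding n_def by blast
qed

theorem theorem1p6:
  fixes l :: nat
  assumes "l \<ge> 3"
  shows "(\<lambda>s::nat. real (ramsey_number s l))
           \<in> \<Omega>(\<lambda>s. 2 powr ((real l - 1) * real s / 2))"
proof (rule landau_omega.bigI)
  \<comment> \<open>The implied constant is the factor split off from
    \<open>2 powr ((l - 1) * (s / 2 - 4))\<close>.\<close>
  show "(0::real) < 2 powr (- 4 * (real l - 1))" by simp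
  show "\<forall>\<^sub>F s in sequentially. 2 powr (- 4 * (real l - 1)) * norm (2 powr ((real l - 1) * real s / 2))
      \<le> norm (real (ramsey_number s l))"
  \<comment> \<open>From \<open>s = 2\<close> on, the dimension \<open>t = s - 1\<close> is at least
    1.\<close>
  proof (rule eventually_sequentiallyI [of 2])
    fix s :: nat assume "2 \<le> s"
    then have "2 powr (real (l - 1) * (real s / 2 - 4)) \<le> real (ramsey_number s l)"
      using ramsey_number_ge [of "s - 1" "l - 1"] assms by simp
    moreover have "real (l - 1) * (real s / 2 - 4) = - 4 * (real l - 1) + (real l - 1) * real s / 2"
      using assms by (simp add: of_nat_diff algebra_simps)
    ultimately show "2 powr (- 4 * (real l - 1)) * norm (2 powr ((real l - 1) * real s / 2))
        \<le> norm (real (ramsey_number s l))"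
      by (simp only: powr_add) simp
  qed
qed

end
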